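(* Let $G$ be an abelian group and let $C \geq 4$ be a real parameter. For any $G$-valued random variables $X,Y$ there is a non-empty finite subset $S$ of $G$ such that, if $U_S$ is a uniform random variable on $S$, then $$d_{\mathrm{ent}}(U_S, Y) \leq (C + 2)\, d_{\mathrm{ent}}(X,Y) + \mathrm{h}\left(1 - \frac{2}{C}\right)$$ and $$\log \frac{ |S - S|}{|S|} \leq (2C + 4)\, d_{\mathrm{ent}}(X,Y) + 2\, \mathrm{h}\left(1 - \frac{2}{C}\right).$$
   Context: A $G$-valued random variable is a random variable taking values in a finite subset of the (additively written) abelian group $G$. Its Shannon entropy is $\mathbf{H}(X) = \sum_x p_X(x)\log\frac{1}{p_X(x)}$, where $p_X(x)=\mathbf{P}(X=x)$, $\log$ is the natural logarithm, and terms with $p_X(x)=0$ are $0$. For $G$-valued random variables $X,Y$ (not necessarily independent or defined on the same sample space), the entropic Ruzsa distance is $$d_{\mathrm{ent}}(X,Y) = \mathbf{H}(X'-Y') - \tfrac12 \mathbf{H}(X') - \tfrac12\mathbf{H}(Y'),$$ where $X',Y'$ are independent copies of $X,Y$ respectively. For $p\in(0,1)$, $\mathrm{h}(p) = p\log\frac1p + (1-p)\log\frac{1}{1-p}$. Also $S-S=\{s-s' : s,s'\in S\}$. *)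

theory Defs
  imports "HOL-Probability.Probability"
begin

(* A G-valued random variable taking finitely many values is a map X with simple_function M X on a
   probability space M; no topology or sigma-algebra on G is involved. *)

(* A term with probability 0 contributes 0, since 1 / 0 = 0 and 0 * t = 0. *)
definition shannon_entropy :: "'b measure \<Rightarrow> ('b \<Rightarrow> 'g) \<Rightarrow> real" where
  "shannon_entropy M X =
     (\<Sum>x\<in>X ` space M. measure M (X -` {x} \<inter> space M) * ln (1 / measure M (X -` {x} \<inter> space M)))"

(* The independent copies of X and Y are realised as the two coordinates of the product space;
   ent_ruzsa_dist_eq_indep_copies below shows that any other choice gives the same value. *)
definition ent_ruzsa_dist ::
    "'b measure \<Rightarrow> ('b \<Rightarrow> 'g::ab_group_add) \<Rightarrow> 'c measure \<Rightarrow> ('c \<Rightarrow> 'g) \<Rightarrow> real" where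
  "ent_ruzsa_dist M X N Y =
     (let P = M \<Otimes>\<^sub>M N; X' = (\<lambda>\<omega>. X (fst \<omega>)); Y' = (\<lambda>\<omega>. Y (snd \<omega>))
      in shannon_entropy P (\<lambda>\<omega>. X' \<omega> - Y' \<omega>) - shannon_entropy P X' / 2 - shannon_entropy P Y' / 2)"

definition binary_entropy :: "real \<Rightarrow> real" where
  "binary_entropy p = p * ln (1 / p) + (1 - p) * ln (1 / (1 - p))"

lemma shannon_entropy_eq_entropy:
  assumes "prob_space M" and "simple_function M X"
  shows "shannon_entropy M X = prob_space.entropy M (exp 1) (count_space (X ` space M)) X"
proof -
  interpret prob_space M by fact
  interpret information_space M "exp 1" by unfold_locales simp
  show ?thesis
    unfolding shannon_entropy_def
    by (subst entropy_simple_distributed[OF simple_distributedI[OF assms(2) measure_nonneg refl]])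
       (auto simp: log_def ln_div ln_inverse divide_inverse sum_negf[symmetric] intro!: sum.cong)
qed

lemma shannon_entropy_superset:
  assumes "finite A" and "X ` space M \<subseteq> A"
  shows "shannon_entropy M X =
    (\<Sum>x\<in>A. measure M (X -` {x} \<inter> space M) * ln (1 / measure M (X -` {x} \<inter> space M)))"
  unfolding shannon_entropy_def
proof (rule sum.mono_neutral_left[OF assms], safe)
  fix x assume "x \<notin> X ` space M"
  then have "X -` {x} \<inter> space M = {}" by auto
  then show "measure M (X -` {x} \<inter> space M) * ln (1 / measure M (X -` {x} \<inter> space M)) = 0"
    by simp
qed

lemma shannon_entropy_cong_law:
  assumes "simple_function M X" and "simple_function N Y"
    and "\<And>x. measure M (X -` {x} \<inter> space M) = measure N (Y -` {x} \<inter> space N)"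
  shows "shannon_entropy M X = shannon_entropy N Y"
proof -
  have fin: "finite (X ` space M \<union> Y ` space N)"
    using assms(1,2) by (simp add: simple_functionD)
  show ?thesis
    by (simp only: shannon_entropy_superset[OF fin Un_upper1] shannon_entropy_superset[OF fin Un_upper2] assms(3))
qed

lemma measure_diff_indep:
  fixes X Y :: "'d \<Rightarrow> 'g::ab_group_add"
  assumes Q: "prob_space Q" and X: "simple_function Q X" and Y: "simple_function Q Y"
    and ind: "\<And>x y. measure Q (X -` {x} \<inter> Y -` {y} \<inter> space Q) =
      measure Q (X -` {x} \<inter> space Q) * measure Q (Y -` {y} \<inter> space Q)"
    and A: "finite A" "X ` space Q \<subseteq> A" and B: "finite B" "Y ` space Q \<subseteq> B"
  shows "measure Q ((\<lambda>\<omega>. X \<omega> - Y \<omega>) -` {z} \<inter> space Q) =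
    (\<Sum>(x, y)\<in>{(x, y). x \<in> A \<and> y \<in> B \<and> x - y = z}.
      measure Q (X -` {x} \<inter> space Q) * measure Q (Y -` {y} \<inter> space Q))"
proof -
  interpret prob_space Q by fact
  let ?I = "{(x, y). x \<in> A \<and> y \<in> B \<and> x - y = z}"
  let ?E = "\<lambda>(x, y). X -` {x} \<inter> Y -` {y} \<inter> space Q"
  have fin: "finite ?I"
    by (rule finite_subset[of _ "A \<times> B"]) (use A B in auto)
  have meas: "?E i \<in> sets Q" for i
  proof -
    have "?E i = (X -` {fst i} \<inter> space Q) \<inter> (Y -` {snd i} \<inter> space Q)"
      by (auto simp: split_beta)
    then show ?thesis
      using simple_functionD(2)[OF X, of "{fst i}"] simple_functionD(2)[OF Y, of "{snd i}"] by auto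
  qed
  have "(\<lambda>\<omega>. X \<omega> - Y \<omega>) -` {z} \<inter> space Q = (\<Union>i\<in>?I. ?E i)"
    using A(2) B(2) by (auto simp: image_subset_iff)
  also have "measure Q \<dots> = (\<Sum>i\<in>?I. measure Q (?E i))"
    by (rule finite_measure_finite_Union[OF fin])
       (use meas in \<open>auto simp: disjoint_family_on_def\<close>)
  also have "\<dots> = (\<Sum>(x, y)\<in>?I. measure Q (X -` {x} \<inter> space Q) * measure Q (Y -` {y} \<inter> space Q))"
    by (rule sum.cong[OF refl]) (auto simp: ind)
  finally show ?thesis .
qed

lemma ent_ruzsa_dist_eq_indep_copies:
  fixes X :: "'b \<Rightarrow> 'g::ab_group_add" and Y :: "'c \<Rightarrow> 'g" and X' Y' :: "'d \<Rightarrow> 'g"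
  assumes M: "prob_space M" and X: "simple_function M X"
    and N: "prob_space N" and Y: "simple_function N Y"
    and Q: "prob_space Q" and X': "simple_function Q X'" and Y': "simple_function Q Y'"
    and law_X: "\<And>x. measure Q (X' -` {x} \<inter> space Q) = measure M (X -` {x} \<inter> space M)"
    and law_Y: "\<And>y. measure Q (Y' -` {y} \<inter> space Q) = measure N (Y -` {y} \<inter> space N)"
    and indep: "prob_space.indep_var Q (count_space UNIV) X' (count_space UNIV) Y'"
  shows "ent_ruzsa_dist M X N Y =
    shannon_entropy Q (\<lambda>\<omega>. X' \<omega> - Y' \<omega>) - shannon_entropy Q X' / 2 - shannon_entropy Q Y' / 2"
proof -
  interpret M: prob_space M by fact
  interpret N: prob_space N by fact
  interpret Q: prob_space Q by fact
  interpret P: pair_prob_space M N ..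
  let ?P = "M \<Otimes>\<^sub>M N"
  let ?X = "\<lambda>\<omega>. X (fst \<omega>)" and ?Y = "\<lambda>\<omega>. Y (snd \<omega>)"
  have eqX: "?X -` {x} \<inter> space ?P = (X -` {x} \<inter> space M) \<times> space N" for x
    by (auto simp: space_pair_measure)
  have eqY: "?Y -` {y} \<inter> space ?P = space M \<times> (Y -` {y} \<inter> space N)" for y
    by (auto simp: space_pair_measure)
  have eqXY: "?X -` {x} \<inter> ?Y -` {y} \<inter> space ?P = (X -` {x} \<inter> space M) \<times> (Y -` {y} \<inter> space N)" for x y
    by (auto simp: space_pair_measure)
  have mX: "X -` {x} \<inter> space M \<in> sets M" for x by (rule simple_functionD[OF X])
  have mY: "Y -` {y} \<inter> space N \<in> sets N" for y by (rule simple_functionD[OF Y])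
  have times: "measure ?P (U \<times> V) = measure M U * measure N V" if "U \<in> sets M" "V \<in> sets N" for U V
    using N.emeasure_pair_measure_Times[OF that] by (simp add: measure_def enn2real_mult)
  have lX: "measure ?P (?X -` {x} \<inter> space ?P) = measure M (X -` {x} \<inter> space M)" for x
    by (simp add: eqX times mX N.prob_space)
  have lY: "measure ?P (?Y -` {y} \<inter> space ?P) = measure N (Y -` {y} \<inter> space N)" for y
    by (simp add: eqY times mY M.prob_space)
  have sX: "simple_function ?P ?X"
    unfolding simple_function_def
  proof safe
    show "finite (?X ` space ?P)"
      by (rule finite_subset[of _ "X ` space M"])
         (use simple_functionD(1)[OF X] in \<open>auto simp: space_pair_measure\<close>)
  qed (simp only: eqX, intro pair_measureI mX sets.top)
  have sY: "simple_function ?P ?Y"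
    unfolding simple_function_def
  proof safe
    show "finite (?Y ` space ?P)"
      by (rule finite_subset[of _ "Y ` space N"])
         (use simple_functionD(1)[OF Y] in \<open>auto simp: space_pair_measure\<close>)
  qed (simp only: eqY, intro pair_measureI mY sets.top)
  have iP: "measure ?P (?X -` {x} \<inter> ?Y -` {y} \<inter> space ?P) =
      measure ?P (?X -` {x} \<inter> space ?P) * measure ?P (?Y -` {y} \<inter> space ?P)" for x y
    by (simp only: eqXY times mX mY lX lY)
  have iQ: "measure Q (X' -` {x} \<inter> Y' -` {y} \<inter> space Q) =
      measure Q (X' -` {x} \<inter> space Q) * measure Q (Y' -` {y} \<inter> space Q)" for x y
  proof -
    have "X' -` {x} \<inter> Y' -` {y} \<inter> space Q = (\<lambda>\<omega>. (X' \<omega>, Y' \<omega>)) -` ({x} \<times> {y}) \<inter> space Q"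
      by auto
    then show ?thesis
      using Q.indep_varD[OF indep, of "{x}" "{y}"] by simp
  qed
  define A where "A = ?X ` space ?P \<union> X' ` space Q"
  define B where "B = ?Y ` space ?P \<union> Y' ` space Q"
  have fin: "finite A" "finite B"
    using simple_functionD(1)[OF sX] simple_functionD(1)[OF sY]
      simple_functionD(1)[OF X'] simple_functionD(1)[OF Y']
    by (auto simp: A_def B_def)
  have "measure ?P ((\<lambda>\<omega>. ?X \<omega> - ?Y \<omega>) -` {z} \<inter> space ?P) =
      measure Q ((\<lambda>\<omega>. X' \<omega> - Y' \<omega>) -` {z} \<inter> space Q)" for z
    by (subst measure_diff_indep[OF P.prob_space_axioms sX sY iP fin(1) _ fin(2)],
        simp add: A_def, simp add: B_def,
        subst measure_diff_indep[OF Q X' Y' iQ fin(1) _ fin(2)],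
        simp add: A_def, simp add: B_def, simp only: lX lY law_X law_Y)
  then have "shannon_entropy ?P (\<lambda>\<omega>. ?X \<omega> - ?Y \<omega>) = shannon_entropy Q (\<lambda>\<omega>. X' \<omega> - Y' \<omega>)"
    by (intro shannon_entropy_cong_law simple_function_diff sX sY X' Y')
  moreover have "shannon_entropy ?P ?X = shannon_entropy Q X'"
    by (rule shannon_entropy_cong_law[OF sX X']) (simp only: lX law_X)
  moreover have "shannon_entropy ?P ?Y = shannon_entropy Q Y'"
    by (rule shannon_entropy_cong_law[OF sY Y']) (simp only: lY law_Y)
  ultimately show ?thesis
    by (simp add: ent_ruzsa_dist_def Let_def)
qed

end

theory Submission
  imports Defs
begin

text \<open>Let \<open>r\<close> be the law of \<open>X' - Y'\<close>, let \<open>c(x) = \<Sum>\<^sub>y P(Y = y) ln (1 / r(x - y))\<close> be the cross entropy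
  of \<open>x - Y\<close> relative to \<open>r\<close>, and write \<open>d\<close> for the distance of \<open>X\<close> and \<open>Y\<close>. Then \<open>c \<ge> H(Y)\<close> on
  the support of \<open>X\<close>, and the mean of \<open>c(X)\<close> is \<open>H(X' - Y') \<le> H(Y) + 2 d\<close>. By Markov's inequality the set
  \<open>S\<close> of all \<open>x\<close> in the support with \<open>c(x) \<le> H(Y) + C d\<close> satisfies \<open>P(X \<in> S) \<ge> 1 - 2 / C \<ge> 1 / 2\<close>.
  Averaging \<open>c\<close> over \<open>S\<close> gives \<open>H(U\<^sub>S - Y) \<le> H(Y) + C d\<close>, and averaging over a set of representatives
  of \<open>S - S\<close> gives \<open>ln |S - S| \<le> H(Y) + 2 C d\<close>. Splitting \<open>X\<close> according to \<open>X \<in> S\<close> yields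
  \<open>ln |S| \<ge> H(Y) - 4 d - 2 h(P(X \<in> S))\<close>. All of this reduces to Gibbs' inequality.\<close>

section \<open>Gibbs' inequality and entropies of finite masses\<close>

definition mass_entropy :: "'a set \<Rightarrow> ('a \<Rightarrow> real) \<Rightarrow> real" where
  "mass_entropy A p = (\<Sum>x\<in>A. p x * ln (1 / p x))"

text \<open>Sum \<open>ln t \<le> t - 1\<close> at \<open>t = m * q x / p x\<close>, where
  \<open>m\<close> is the total mass of \<open>p\<close>. Letting \<open>m\<close> be arbitrary
  makes the bound applicable to the restriction of a law to a subset, and \<open>q\<close> may be a
  sub-probability, as happens when only part of a law is sampled.\<close>

lemma gibbs_inequality:
  fixes p q :: "'a \<Rightarrow> real"
  assumes A: "finite A" and p: "\<And>x. x \<in> A \<Longrightarrow> 0 \<le> p x" and q: "\<And>x. x \<in> A \<Longrightarrow> 0 \<le> q x"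
    and ac: "\<And>x. x \<in> A \<Longrightarrow> 0 < p x \<Longrightarrow> 0 < q x"
    and q1: "sum q A \<le> 1"
  shows "mass_entropy A p - sum p A * ln (1 / sum p A) \<le> (\<Sum>x\<in>A. p x * ln (1 / q x))"
proof (cases "sum p A = 0")
  case True
  then have "p x = 0" if "x \<in> A" for x
    using sum_nonneg_eq_0_iff[OF A, of p] p that by auto
  then show ?thesis by (simp add: mass_entropy_def True)
next
  case False
  define m where "m = sum p A"
  have m: "m > 0" using False sum_nonneg[of A p] p by (simp add: m_def less_le)
  have "p x * ln (1 / p x) - p x * ln (1 / m) - p x * ln (1 / q x) \<le> m * q x - p x" if "x \<in> A" for x
  proof (cases "p x = 0")
    case True
    then show ?thesis using q[OF that] m by simp
  next
    case False
    then have px: "p x > 0" using p[OF that] by simp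
    then have qx: "q x > 0" using ac that by simp
    have "p x * ln (1 / p x) - p x * ln (1 / m) - p x * ln (1 / q x) = p x * ln (m * q x / p x)"
      using px qx m by (simp add: ln_div ln_mult algebra_simps)
    also have "\<dots> \<le> p x * (m * q x / p x - 1)"
      by (intro mult_left_mono ln_le_minus_one) (use px qx m in auto)
    also have "\<dots> = m * q x - p x"
      using px by (simp add: field_simps)
    finally show ?thesis .
  qed
  then have "(\<Sum>x\<in>A. p x * ln (1 / p x) - p x * ln (1 / m) - p x * ln (1 / q x)) \<le> (\<Sum>x\<in>A. m * q x - p x)"
    by (rule sum_mono)
  also have "\<dots> = m * sum q A - m"
    by (simp add: sum_subtractf sum_distrib_left m_def)
  also have "\<dots> \<le> 0"
    using m q1 mult_left_mono[OF q1, of m] by simp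
  finally show ?thesis
    by (simp add: mass_entropy_def m_def sum_subtractf sum_distrib_right)
qed

text \<open>Gibbs' inequality against the uniform mass on \<open>A\<close>.\<close>

lemma mass_entropy_le_ln_card:
  assumes "finite A" and "A \<noteq> {}" and "\<And>x. x \<in> A \<Longrightarrow> 0 \<le> p x"
  shows "mass_entropy A p \<le> sum p A * ln (card A) + sum p A * ln (1 / sum p A)"
  using gibbs_inequality[of A p "\<lambda>_. 1 / card A"] assms
  by (simp add: sum_distrib_right[symmetric] card_gt_0_iff)

text \<open>Gibbs' inequality for the two-point masses (p, 1 - p) and (q, 1 - q), realised on the
  booleans by \<open>?f\<close>. The resulting cross entropy differs from the entropy at
  \<open>q\<close> by \<open>p - q\<close> times the log-odds of \<open>q\<close>, which are
  nonnegative because \<open>q\<close> is at least 1/2.\<close>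

lemma binary_entropy_antimono:
  assumes "1 / 2 \<le> q" and "q \<le> p" and "p \<le> 1" and "q < 1"
  shows "binary_entropy p \<le> binary_entropy q"
proof -
  let ?f = "\<lambda>t c. if c then t else 1 - t :: real"
  have "binary_entropy p \<le> p * ln (1 / q) + (1 - p) * ln (1 / (1 - q))"
  proof -
    have "mass_entropy UNIV (?f p) - sum (?f p) UNIV * ln (1 / sum (?f p) UNIV)
        \<le> (\<Sum>c\<in>UNIV. ?f p c * ln (1 / ?f q c))"
      by (rule gibbs_inequality) (use assms in \<open>auto simp: UNIV_bool split: if_splits\<close>)
    then show ?thesis
      by (simp add: mass_entropy_def UNIV_bool binary_entropy_def ac_simps)
  qed
  also have "\<dots> = binary_entropy q - (p - q) * (ln q - ln (1 - q))"
    using assms by (simp add: binary_entropy_def ln_div algebra_simps)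
  also have "\<dots> \<le> binary_entropy q"
    using assms by simp
  finally show ?thesis .
qed

section \<open>Masses on an abelian group and the law of a difference\<close>

locale finite_mass =
  fixes A :: "'a set" and p :: "'a \<Rightarrow> real"
  assumes finite: "finite A"
    and pos: "x \<in> A \<Longrightarrow> 0 < p x"
    and outside: "x \<notin> A \<Longrightarrow> p x = 0"
    and sum_eq_1: "sum p A = 1"
begin

lemma nonneg: "0 \<le> p x"
  using pos[of x] outside[of x] by (cases "x \<in> A") auto

end

text \<open>The convolution of \<open>p\<close> with the reflection of \<open>b\<close>, that is,
  the law of X' - Y' for independent X', Y' with masses \<open>p\<close>, \<open>b\<close>.\<close>

definition diff_mass :: "'g::ab_group_add set \<Rightarrow> ('g \<Rightarrow> real) \<Rightarrow> ('g \<Rightarrow> real) \<Rightarrow> 'g \<Rightarrow> real" where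
  "diff_mass B p b z = (\<Sum>y\<in>B. p (z + y) * b y)"

definition diff_set :: "'g::ab_group_add set \<Rightarrow> 'g set \<Rightarrow> 'g set" where
  "diff_set A B = (\<lambda>(x, y). x - y) ` (A \<times> B)"

definition mass_ruzsa_dist ::
    "'g::ab_group_add set \<Rightarrow> ('g \<Rightarrow> real) \<Rightarrow> 'g set \<Rightarrow> ('g \<Rightarrow> real) \<Rightarrow> real" where
  "mass_ruzsa_dist A p B b =
     mass_entropy (diff_set A B) (diff_mass B p b) - mass_entropy A p / 2 - mass_entropy B b / 2"

locale two_masses = X: finite_mass A p + Y: finite_mass B b
  for A B :: "'g::ab_group_add set" and p b
begin

abbreviation r where "r \<equiv> diff_mass B p b"
abbreviation D where "D \<equiv> diff_set A B"
abbreviation "dist_XY \<equiv> mass_ruzsa_dist A p B b"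

lemma finite_D: "finite D"
  by (simp add: diff_set_def X.finite Y.finite)

text \<open>The expectation of g(X' - Y'), computed by the substitution x = z + y for each fixed
  y.\<close>

lemma sum_diff_mass:
  "(\<Sum>z\<in>D. r z * g z) = (\<Sum>x\<in>A. p x * (\<Sum>y\<in>B. b y * g (x - y)))"
proof -
  \<comment> \<open>The translate of \<open>A\<close> by -y lies in \<open>D\<close>; at every other
    point z of \<open>D\<close> the factor \<open>p (z + y)\<close> vanishes.\<close>
  have *: "(\<Sum>z\<in>D. p (z + y) * g z) = (\<Sum>x\<in>A. p x * g (x - y))" if "y \<in> B" for y
  proof -
    have "(\<Sum>x\<in>A. p x * g (x - y)) = (\<Sum>z\<in>(\<lambda>x. x - y) ` A. p (z + y) * g z)"
      by (subst sum.reindex) (auto simp: inj_on_def)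
    also have "\<dots> = (\<Sum>z\<in>D. p (z + y) * g z)"
    proof (rule sum.mono_neutral_left[OF finite_D])
      show "(\<lambda>x. x - y) ` A \<subseteq> D" using that by (auto simp: diff_set_def)
      show "\<forall>z\<in>D - (\<lambda>x. x - y) ` A. p (z + y) * g z = 0"
      proof
        fix z assume z: "z \<in> D - (\<lambda>x. x - y) ` A"
        have "z + y \<notin> A"
        proof
          assume "z + y \<in> A"
          then have "z + y - y \<in> (\<lambda>x. x - y) ` A" by (rule imageI)
          with z show False by simp
        qed
        then show "p (z + y) * g z = 0" by (simp add: X.outside)
      qed
    qed
    finally show ?thesis ..
  qed
  have "(\<Sum>z\<in>D. r z * g z) = (\<Sum>y\<in>B. \<Sum>z\<in>D. b y * (p (z + y) * g z))"
    by (subst sum.swap) (simp add: diff_mass_def sum_distrib_right sum_distrib_left ac_simps)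
  also have "\<dots> = (\<Sum>y\<in>B. b y * (\<Sum>x\<in>A. p x * g (x - y)))"
    by (simp add: sum_distrib_left[symmetric] *)
  also have "\<dots> = (\<Sum>x\<in>A. p x * (\<Sum>y\<in>B. b y * g (x - y)))"
    by (simp add: sum_distrib_left, subst sum.swap) (simp add: ac_simps)
  finally show ?thesis .
qed

lemma diff_mass_nonneg: "0 \<le> r z"
  by (auto simp: diff_mass_def intro!: sum_nonneg mult_nonneg_nonneg X.nonneg Y.nonneg)

lemma diff_mass_pos: "0 < r (x - y)" if "x \<in> A" "y \<in> B"
proof -
  have "0 < p (x - y + y) * b y" using that X.pos Y.pos by simp
  also have "\<dots> \<le> r (x - y)"
    unfolding diff_mass_def
    by (rule member_le_sum) (use that X.nonneg Y.nonneg Y.finite in auto)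
  finally show ?thesis .
qed

lemma diff_mass_outside: "r z = 0" if "z \<notin> D"
  unfolding diff_mass_def
proof (rule sum.neutral, rule ballI)
  fix y assume "y \<in> B"
  then have "z + y \<notin> A"
    using that by (force simp: diff_set_def image_iff)
  then show "p (z + y) * b y = 0" by (simp add: X.outside)
qed

sublocale diff: finite_mass D r
proof
  show "0 < r z" if "z \<in> D" for z
    using that diff_mass_pos by (auto simp: diff_set_def)
  show "sum r D = 1"
    using sum_diff_mass[of "\<lambda>_. 1"] by (simp add: X.sum_eq_1 Y.sum_eq_1)
qed (simp_all add: finite_D diff_mass_outside)

text \<open>Supplies the sub-probability hypothesis of Gibbs' inequality whenever \<open>r\<close>
  is evaluated along an injective family, such as a translate or reflected translate of a set; the
  family need not cover \<open>D\<close>, hence only an inequality.\<close>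

lemma sum_diff_mass_le_1: "(\<Sum>i\<in>I. r (f i)) \<le> 1" if "finite I" "inj_on f I"
proof -
  have "(\<Sum>i\<in>I. r (f i)) = (\<Sum>z\<in>f ` I. r z)"
    by (simp add: sum.reindex that)
  also have "\<dots> \<le> (\<Sum>z\<in>f ` I \<union> D. r z)"
    by (rule sum_mono2) (use that finite_D diff_mass_nonneg in auto)
  also have "\<dots> = sum r D"
    by (rule sum.mono_neutral_right) (use that finite_D diff_mass_outside in auto)
  finally show ?thesis by (simp add: diff.sum_eq_1)
qed

section \<open>Cross entropy relative to the law of the difference\<close>

definition cross where
  "cross x = (\<Sum>y\<in>B. b y * ln (1 / r (x - y)))"

lemma entropy_diff_eq: "mass_entropy D r = (\<Sum>x\<in>A. p x * cross x)"
  unfolding mass_entropy_def cross_def by (rule sum_diff_mass)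

text \<open>Gibbs' inequality for \<open>b\<close> against \<open>r (x - y)\<close> as a function of
  y.\<close>

lemma cross_ge: "mass_entropy B b \<le> cross x" if "x \<in> A"
  using gibbs_inequality[OF Y.finite, of b "\<lambda>y. r (x - y)"] that
  by (simp add: cross_def Y.nonneg Y.sum_eq_1 diff_mass_nonneg diff_mass_pos
      sum_diff_mass_le_1 Y.finite inj_on_def)

text \<open>Here the roles are exchanged: for each fixed y, Gibbs' inequality compares
  \<open>p\<close> on \<open>A'\<close> with \<open>r (x - y)\<close> as a function of x, and the
  result is averaged over y. The correction term accounts for the total mass of \<open>p\<close> on
  \<open>A'\<close>.\<close>

lemma sum_cross_ge:
  assumes "A' \<subseteq> A"
  shows "mass_entropy A' p - sum p A' * ln (1 / sum p A') \<le> (\<Sum>x\<in>A'. p x * cross x)"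
proof -
  have fin: "finite A'" using assms X.finite finite_subset by blast
  have "mass_entropy A' p - sum p A' * ln (1 / sum p A') =
      (\<Sum>y\<in>B. b y * (mass_entropy A' p - sum p A' * ln (1 / sum p A')))"
    by (simp add: sum_distrib_right[symmetric] Y.sum_eq_1)
  also have "\<dots> \<le> (\<Sum>y\<in>B. b y * (\<Sum>x\<in>A'. p x * ln (1 / r (x - y))))"
    by (intro sum_mono mult_left_mono gibbs_inequality sum_diff_mass_le_1 fin Y.nonneg X.nonneg
        diff_mass_nonneg diff_mass_pos) (use assms in \<open>auto simp: inj_on_def\<close>)
  also have "\<dots> = (\<Sum>x\<in>A'. p x * cross x)"
    by (simp add: cross_def sum_distrib_left, subst sum.swap) (simp add: ac_simps)
  finally show ?thesis .
qed

text \<open>The two bounds average over y and over x respectively. Together they make the distance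
  nonnegative and bound the difference of the entropies of \<open>p\<close> and \<open>b\<close> by
  twice the distance.\<close>

lemma entropy_diff_ge: "mass_entropy A p \<le> mass_entropy D r" "mass_entropy B b \<le> mass_entropy D r"
proof -
  show "mass_entropy A p \<le> mass_entropy D r"
    using sum_cross_ge[of A] by (simp add: entropy_diff_eq X.sum_eq_1)
  have "(\<Sum>x\<in>A. p x * mass_entropy B b) \<le> (\<Sum>x\<in>A. p x * cross x)"
    by (intro sum_mono mult_left_mono cross_ge X.nonneg)
  then show "mass_entropy B b \<le> mass_entropy D r"
    by (simp add: entropy_diff_eq X.sum_eq_1 sum_distrib_right[symmetric])
qed

lemma dist_nonneg: "0 \<le> dist_XY"
  using entropy_diff_ge by (simp add: mass_ruzsa_dist_def)

section \<open>Bounds for subsets of the support, and the choice of \<open>S\<close>\<close>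

lemma entropy_uniform_diff_le:
  assumes S: "S \<subseteq> A" "S \<noteq> {}" and le: "\<And>s. s \<in> S \<Longrightarrow> cross s \<le> K"
  shows "mass_ruzsa_dist S (\<lambda>x. indicator S x / card S) B b \<le> K - ln (card S) / 2 - mass_entropy B b / 2"
proof -
  let ?u = "\<lambda>x. indicator S x / card S :: real"
  have fin: "finite S" using S X.finite finite_subset by blast
  then have card: "card S > 0" using S by (simp add: card_gt_0_iff)
  interpret U: two_masses S B ?u b
    by unfold_locales (use fin card in auto)
  \<comment> \<open>The law of U_S - Y is compared with \<open>r\<close> instead of being computed:
    the cross entropy of the two is exactly the average of \<open>cross\<close> over
    \<open>S\<close>.\<close>
  have "mass_entropy U.D U.r \<le> (\<Sum>z\<in>U.D. U.r z * ln (1 / r z))"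
  proof -
    have "0 < r z" if "z \<in> U.D" for z
      using that S diff_mass_pos by (auto simp: diff_set_def)
    then show ?thesis
      using gibbs_inequality[OF U.finite_D, of U.r r] sum_diff_mass_le_1[OF U.finite_D, of id]
      by (simp add: U.diff_mass_nonneg diff_mass_nonneg U.diff.sum_eq_1)
  qed
  also have "\<dots> = (\<Sum>s\<in>S. ?u s * cross s)"
    unfolding U.sum_diff_mass cross_def ..
  also have "\<dots> \<le> (\<Sum>s\<in>S. ?u s * K)"
    by (intro sum_mono mult_left_mono le) auto
  also have "\<dots> = K"
    using card by simp
  finally have "mass_entropy U.D U.r \<le> K" .
  moreover have "mass_entropy S ?u = ln (card S)"
    using card by (simp add: mass_entropy_def)
  ultimately show ?thesis
    by (simp add: mass_ruzsa_dist_def)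
qed

text \<open>An entropic Ruzsa triangle inequality: choosing a representation \<open>z = s - s'\<close> of each
  difference, the pair \<open>(s - y, s' - y)\<close> determines \<open>(z, y)\<close>.\<close>

lemma ln_card_diff_le:
  assumes S: "S \<subseteq> A" "S \<noteq> {}" and le: "\<And>s. s \<in> S \<Longrightarrow> cross s \<le> K"
  shows "ln (card (diff_set S S)) \<le> 2 * K - mass_entropy B b"
proof -
  let ?T = "diff_set S S"
  have fin: "finite S" using S X.finite finite_subset by blast
  then have finT: "finite ?T" by (simp add: diff_set_def)
  have T: "card ?T > 0" using finT S by (auto simp: card_gt_0_iff diff_set_def)
  have "\<forall>z\<in>?T. \<exists>s s'. s \<in> S \<and> s' \<in> S \<and> z = s - s'"
    by (auto simp: diff_set_def)
  then obtain f g where fg: "\<And>z. z \<in> ?T \<Longrightarrow> f z \<in> S \<and> g z \<in> S \<and> z = f z - g z"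
    by metis
  \<comment> \<open>\<open>?w\<close> is the law of (Z, Y) with Z uniform on \<open>?T\<close> and
    independent of Y. \<open>?q\<close> is the product law of two copies of \<open>r\<close>, pulled
    back along \<open>?e\<close>; injectivity of \<open>?e\<close> keeps its total mass at most
    1.\<close>
  let ?w = "\<lambda>(z, y). b y / card ?T"
  let ?q = "\<lambda>(z, y). r (f z - y) * r (g z - y)"
  let ?e = "\<lambda>(z, y). (f z - y, g z - y)"
  have inj: "inj_on ?e (?T \<times> B)"
  proof (rule inj_onI, clarsimp)
    fix z y z' y'
    assume *: "z \<in> ?T" "z' \<in> ?T" "f z - y = f z' - y'" "g z - y = g z' - y'"
    have "z = (f z - y) - (g z - y)" using fg[OF *(1)] by simp
    also have "\<dots> = z'" using fg[OF *(2)] * by simp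
    finally show "z = z' \<and> y = y'" using * by simp
  qed
  have sub: "?e ` (?T \<times> B) \<subseteq> D \<times> D"
    using fg S by (fastforce simp: diff_set_def)
  have "sum ?q (?T \<times> B) = (\<Sum>(u, v)\<in>?e ` (?T \<times> B). r u * r v)"
    by (subst sum.reindex[OF inj]) (simp add: case_prod_beta)
  also have "\<dots> \<le> (\<Sum>(u, v)\<in>D \<times> D. r u * r v)"
    by (rule sum_mono2[OF _ sub]) (auto simp: finite_D diff_mass_nonneg)
  also have "\<dots> = 1"
    by (simp add: sum.cartesian_product[symmetric] sum_distrib_left[symmetric]
        diff.sum_eq_1)
  finally have q1: "sum ?q (?T \<times> B) \<le> 1" .
  have qpos: "0 < r (f z - y)" "0 < r (g z - y)" if "z \<in> ?T" "y \<in> B" for z y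
    using fg[OF that(1)] that(2) S by (auto intro!: diff_mass_pos)
  have w1: "sum ?w (?T \<times> B) = 1"
    using T by (simp add: sum.cartesian_product[symmetric] sum_divide_distrib[symmetric] Y.sum_eq_1)
  have "mass_entropy (?T \<times> B) ?w = (\<Sum>z\<in>?T. \<Sum>y\<in>B. (b y * ln (1 / b y) + b y * ln (card ?T)) / card ?T)"
    unfolding mass_entropy_def sum.cartesian_product' prod.case
    by (intro sum.cong refl) (use T Y.pos in \<open>simp add: ln_div ln_mult field_simps\<close>)
  also have "\<dots> = mass_entropy B b + ln (card ?T)"
    using T by (simp add: sum_divide_distrib[symmetric] sum.distrib sum_distrib_right[symmetric]
        Y.sum_eq_1 mass_entropy_def)
  finally have ent: "mass_entropy (?T \<times> B) ?w = mass_entropy B b + ln (card ?T)" .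
  \<comment> \<open>The logarithm of the product \<open>?q\<close> splits, so Gibbs' inequality
    bounds the joint entropy by an average of \<open>cross (f z) + cross (g z)\<close>.\<close>
  have "mass_entropy (?T \<times> B) ?w \<le> (\<Sum>i\<in>?T \<times> B. ?w i * ln (1 / ?q i))"
    using gibbs_inequality[of "?T \<times> B" ?w ?q] q1 w1 finT Y.finite qpos
    by (auto simp: Y.nonneg diff_mass_nonneg)
  also have "\<dots> = (\<Sum>z\<in>?T. \<Sum>y\<in>B. (b y * ln (1 / r (f z - y)) + b y * ln (1 / r (g z - y))) / card ?T)"
    unfolding sum.cartesian_product' prod.case
    by (intro sum.cong refl) (simp add: qpos qpos[THEN less_imp_neq, symmetric] ln_div ln_mult field_simps)
  also have "\<dots> = (\<Sum>z\<in>?T. cross (f z) + cross (g z)) / card ?T"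
    by (simp add: sum_divide_distrib[symmetric] sum.distrib cross_def)
  also have "\<dots> \<le> (\<Sum>z\<in>?T. 2 * K) / card ?T"
  proof (intro divide_right_mono sum_mono)
    show "cross (f z) + cross (g z) \<le> 2 * K" if "z \<in> ?T" for z
      using add_mono[OF le le, of "f z" "g z"] fg[OF that] by auto
  qed simp
  also have "\<dots> = 2 * K"
    using T by simp
  finally show ?thesis by (simp add: ent)
qed

text \<open>The mean of \<open>cross\<close> is bounded below by \<open>cross_ge\<close> on
  \<open>S\<close> and by \<open>sum_cross_ge\<close> off \<open>S\<close>, while the entropy of
  \<open>p\<close> on \<open>S\<close> is bounded above through the cardinality of \<open>S\<close>.
  The correction terms of both parts add up to the binary entropy of the mass of
  \<open>S\<close>.\<close>

lemma ln_card_ge: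
  assumes S: "S \<subseteq> A" and half: "1 / 2 \<le> sum p S"
  shows "ln (card S) \<ge> mass_entropy B b - 4 * dist_XY - 2 * binary_entropy (sum p S)"
proof -
  define m where "m = sum p S"
  have fin: "finite S" using S X.finite finite_subset by blast
  have ne: "S \<noteq> {}" using half by auto
  have split: "sum h A = sum h S + sum h (A - S)" for h :: "'g \<Rightarrow> real"
    using sum.subset_diff[OF S X.finite, of h] by simp
  have m': "sum p (A - S) = 1 - m"
    using split[of p] by (simp add: X.sum_eq_1 m_def)
  have m: "m \<le> 1" using m' sum_nonneg[of "A - S" p] X.nonneg by simp
  have "m * mass_entropy B b \<le> (\<Sum>x\<in>S. p x * cross x)"
    unfolding m_def sum_distrib_right
    by (intro sum_mono mult_left_mono cross_ge X.nonneg) (use S in auto)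
  moreover have "mass_entropy (A - S) p - (1 - m) * ln (1 / (1 - m)) \<le> (\<Sum>x\<in>A - S. p x * cross x)"
    using sum_cross_ge[of "A - S"] by (simp add: m')
  moreover have "mass_entropy S p \<le> m * ln (card S) + m * ln (1 / m)"
    using mass_entropy_le_ln_card[OF fin ne, of p] by (simp add: m_def X.nonneg)
  moreover have "mass_entropy A p = mass_entropy S p + mass_entropy (A - S) p"
    unfolding mass_entropy_def by (rule split)
  moreover have "mass_entropy D r = (\<Sum>x\<in>S. p x * cross x) + (\<Sum>x\<in>A - S. p x * cross x)"
    unfolding entropy_diff_eq by (rule split)
  ultimately have "mass_entropy A p + m * mass_entropy B b
      \<le> m * ln (card S) + binary_entropy m + mass_entropy D r"
    unfolding binary_entropy_def by linarith
  \<comment> \<open>This gives H(X' - Y') - H(X) \<le> 2 d, with d the distance, which removes both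
    entropies from the previous bound.\<close>
  moreover have "mass_entropy B b \<le> mass_entropy A p + 2 * dist_XY"
    using entropy_diff_ge by (simp add: mass_ruzsa_dist_def)
  ultimately have *: "m * (mass_entropy B b - ln (card S)) \<le> 2 * dist_XY + binary_entropy m"
    by (simp add: mass_ruzsa_dist_def algebra_simps)
  \<comment> \<open>Dividing by \<open>m\<close>, which is at least 1/2, costs a factor 2. This is
    legitimate only for a positive left side; otherwise the right side is nonnegative
    anyway.\<close>
  have "mass_entropy B b - ln (card S) \<le> 2 * (2 * dist_XY + binary_entropy m)"
  proof (cases "mass_entropy B b - ln (card S) \<le> 0")
    case True
    have "0 \<le> binary_entropy m"
      unfolding binary_entropy_def using half m
      \<comment> \<open>At \<open>m = 1\<close> the argument of the second logarithm is 1 / 0 = 0,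
        which is not at least 1, but its coefficient vanishes.\<close>
      by (cases "m = 1") (auto intro!: add_nonneg_nonneg mult_nonneg_nonneg simp: m_def[symmetric])
    then show ?thesis using True dist_nonneg by simp
  next
    case False
    then have "1 / 2 * (mass_entropy B b - ln (card S)) \<le> m * (mass_entropy B b - ln (card S))"
      by (intro mult_right_mono) (use half m_def in auto)
    with * show ?thesis by simp
  qed
  then show ?thesis by (simp add: m_def)
qed

text \<open>Markov's inequality for the excess \<open>?E\<close>, which is nonnegative on
  \<open>A\<close> and has mean at most twice the distance.\<close>

lemma markov_cross:
  fixes C :: real
  assumes "C > 0"
  defines "S \<equiv> {x \<in> A. cross x \<le> mass_entropy B b + C * dist_XY}"
  shows "1 - 2 / C \<le> sum p S"
proof -
  let ?d = "dist_XY" and ?E = "\<lambda>x. cross x - mass_entropy B b"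
  have "S \<subseteq> A" by (auto simp: S_def)
  then have m: "sum p (A - S) = 1 - sum p S"
    using sum.subset_diff[OF _ X.finite, of S p] by (simp add: X.sum_eq_1)
  have "(\<Sum>x\<in>A. p x * ?E x) = mass_entropy D r - mass_entropy B b"
    by (simp add: right_diff_distrib sum_subtractf entropy_diff_eq sum_distrib_right[symmetric] X.sum_eq_1)
  then have le: "(\<Sum>x\<in>A. p x * ?E x) \<le> 2 * ?d"
    using entropy_diff_ge by (simp add: mass_ruzsa_dist_def)
  have sub: "(\<Sum>x\<in>A - S. p x * ?E x) \<le> (\<Sum>x\<in>A. p x * ?E x)"
    by (rule sum_mono2) (auto simp: X.finite X.nonneg cross_ge)
  show ?thesis
  proof (cases "?d = 0")
    \<comment> \<open>With threshold 0 Markov's inequality says nothing. Instead, a nonnegative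
      excess of mean at most 0 vanishes wherever \<open>p\<close> is positive, so \<open>S\<close>
      is all of \<open>A\<close>.\<close>
    case True
    have "A - S = {}"
    proof (rule ccontr)
      assume "A - S \<noteq> {}"
      then have "0 < (\<Sum>x\<in>A - S. p x * ?E x)"
        by (intro sum_pos) (auto simp: X.finite X.pos S_def True)
      with sub le True show False by simp
    qed
    then have "sum p (A - S) = 0" by (simp only: sum.empty)
    then show ?thesis using m \<open>C > 0\<close> by simp
  next
    case False
    then have d: "?d > 0" using dist_nonneg by simp
    have "sum p (A - S) * (C * ?d) \<le> (\<Sum>x\<in>A - S. p x * ?E x)"
      unfolding sum_distrib_right
      by (intro sum_mono mult_left_mono X.nonneg) (auto simp: S_def)
    with sub le have "sum p (A - S) * (C * ?d) \<le> 2 * ?d" by simp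
    then have "sum p (A - S) * C \<le> 2"
      using d mult_le_cancel_right[of "sum p (A - S) * C" ?d 2] by (simp add: ac_simps)
    then show ?thesis using m \<open>C > 0\<close> by (simp add: field_simps)
  qed
qed

lemma exists_small_doubling_set:
  fixes C :: real
  assumes C: "C \<ge> 4"
  shows "\<exists>S. S \<noteq> {} \<and> finite S \<and>
    mass_ruzsa_dist S (\<lambda>x. indicator S x / card S) B b
      \<le> (C + 2) * dist_XY + binary_entropy (1 - 2 / C) \<and>
    ln (card (diff_set S S) / card S)
      \<le> (2 * C + 4) * dist_XY + 2 * binary_entropy (1 - 2 / C)"
proof -
  define K where "K = mass_entropy B b + C * dist_XY"
  define S where "S = {x \<in> A. cross x \<le> K}"
  have S: "S \<subseteq> A" and le: "\<And>s. s \<in> S \<Longrightarrow> cross s \<le> K" by (auto simp: S_def)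
  have fin: "finite S" using S X.finite finite_subset by blast
  have m: "1 - 2 / C \<le> sum p S"
    using markov_cross[of C] C by (simp add: S_def K_def)
  \<comment> \<open>This is where \<open>C \<ge> 4\<close> enters: both \<open>ln_card_ge\<close>
    and the monotonicity of the binary entropy need masses of at least 1/2.\<close>
  have half: "1 / 2 \<le> 1 - 2 / C" using C by (simp add: field_simps)
  have ne: "S \<noteq> {}" using m half by auto
  have "sum p S \<le> 1"
    using sum_mono2[OF X.finite S, of p] X.nonneg by (simp add: X.sum_eq_1)
  then have "binary_entropy (sum p S) \<le> binary_entropy (1 - 2 / C)"
    using m half C by (intro binary_entropy_antimono) auto
  then have card: "mass_entropy B b - 4 * dist_XY - 2 * binary_entropy (1 - 2 / C) \<le> ln (card S)"
    using ln_card_ge[OF S] m half by simp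
  have pos: "card S > 0" "card (diff_set S S) > 0"
    using fin ne by (auto simp: card_gt_0_iff diff_set_def)
  \<comment> \<open>In 2 K - H(Y) - ln |S| the entropies cancel, leaving 2 C d from \<open>K\<close>
    and 4 d plus twice the binary entropy from \<open>card\<close>. In the distance bound below ln
    |S| enters with weight 1/2, which halves the contribution of \<open>card\<close>.\<close>
  have "ln (card (diff_set S S) / card S) \<le> (2 * C + 4) * dist_XY + 2 * binary_entropy (1 - 2 / C)"
    using ln_card_diff_le[OF S ne le] card pos by (simp add: ln_div K_def algebra_simps)
  moreover have "mass_ruzsa_dist S (\<lambda>x. indicator S x / card S) B b
      \<le> (C + 2) * dist_XY + binary_entropy (1 - 2 / C)"
    using entropy_uniform_diff_le[OF S ne le] card by (simp add: K_def algebra_simps)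
  ultimately show ?thesis using ne fin by blast
qed

end

section \<open>Transfer from masses to random variables\<close>

definition law :: "'b measure \<Rightarrow> ('b \<Rightarrow> 'g) \<Rightarrow> 'g \<Rightarrow> real" where
  "law M X x = measure M (X -` {x} \<inter> space M)"

text \<open>The atoms of the law are used instead of the range of \<open>X\<close>, which may
  contain values of probability 0, whereas \<open>finite_mass\<close> asks for strict positivity on
  its carrier.\<close>

definition law_support :: "'b measure \<Rightarrow> ('b \<Rightarrow> 'g) \<Rightarrow> 'g set" where
  "law_support M X = {x. law M X x \<noteq> 0}"

lemma law_support_subset: "law_support M X \<subseteq> X ` space M"
proof -
  have "law M X x = 0" if "x \<notin> X ` space M" for x
  proof -
    have "X -` {x} \<inter> space M = {}" using that by auto
    then show ?thesis by (simp add: law_def)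
  qed
  then show ?thesis by (auto simp: law_support_def)
qed

lemma finite_mass_law:
  assumes "prob_space M" and X: "simple_function M X"
  shows "finite_mass (law_support M X) (law M X)"
proof
  interpret prob_space M by fact
  have fin: "finite (X ` space M)" by (rule simple_functionD(1)[OF X])
  show "finite (law_support M X)"
    using law_support_subset fin by (rule finite_subset)
  show "0 < law M X x" if "x \<in> law_support M X" for x
    using that measure_nonneg[of M "X -` {x} \<inter> space M"] by (simp add: law_support_def law_def less_le)
  show "law M X x = 0" if "x \<notin> law_support M X" for x
    using that by (simp add: law_support_def)
  have "sum (law M X) (law_support M X) = sum (law M X) (X ` space M)"
    by (rule sum.mono_neutral_left[OF fin law_support_subset]) (auto simp: law_support_def)
  also have "\<dots> = measure M (\<Union>x\<in>X ` space M. X -` {x} \<inter> space M)"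
    unfolding law_def
    by (rule finite_measure_finite_Union[symmetric, OF fin])
       (use simple_functionD(2)[OF X] in \<open>auto simp: disjoint_family_on_def\<close>)
  also have "(\<Union>x\<in>X ` space M. X -` {x} \<inter> space M) = space M" by auto
  finally show "sum (law M X) (law_support M X) = 1" by (simp add: prob_space)
qed

lemma shannon_entropy_eq_mass_entropy:
  assumes fin: "finite (X ` space M)" "finite A" and A: "\<And>x. x \<notin> A \<Longrightarrow> law M X x = 0"
  shows "shannon_entropy M X = mass_entropy A (law M X)"
proof -
  have "shannon_entropy M X = mass_entropy (X ` space M \<union> A) (law M X)"
    using shannon_entropy_superset[of "X ` space M \<union> A" X M] fin
    by (simp add: mass_entropy_def law_def)
  also have "\<dots> = mass_entropy A (law M X)"
    unfolding mass_entropy_def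
    by (rule sum.mono_neutral_right) (use fin A in auto)
  finally show ?thesis .
qed

text \<open>On the product space the coordinates keep their laws and are independent, so the law of
  their difference is the convolution \<open>r\<close>.\<close>

lemma ent_ruzsa_dist_eq_mass_ruzsa_dist:
  fixes X :: "'b \<Rightarrow> 'g::ab_group_add" and Y :: "'c \<Rightarrow> 'g"
  assumes M: "prob_space M" and X: "simple_function M X"
    and N: "prob_space N" and Y: "simple_function N Y"
  shows "ent_ruzsa_dist M X N Y =
    mass_ruzsa_dist (law_support M X) (law M X) (law_support N Y) (law N Y)"
proof -
  interpret M: prob_space M by fact
  interpret N: prob_space N by fact
  interpret P: pair_prob_space M N ..
  let ?A = "law_support M X" and ?B = "law_support N Y"
  interpret two_masses ?A ?B "law M X" "law N Y"
    by (intro two_masses.intro finite_mass_law assms)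
  let ?P = "M \<Otimes>\<^sub>M N"
  let ?X = "\<lambda>\<omega>. X (fst \<omega>)" and ?Y = "\<lambda>\<omega>. Y (snd \<omega>)"
  have eqX: "?X -` {x} \<inter> space ?P = (X -` {x} \<inter> space M) \<times> space N" for x
    by (auto simp: space_pair_measure)
  have eqY: "?Y -` {y} \<inter> space ?P = space M \<times> (Y -` {y} \<inter> space N)" for y
    by (auto simp: space_pair_measure)
  have eqXY: "?X -` {x} \<inter> ?Y -` {y} \<inter> space ?P = (X -` {x} \<inter> space M) \<times> (Y -` {y} \<inter> space N)" for x y
    by (auto simp: space_pair_measure)
  note mX = simple_functionD(2)[OF X] and mY = simple_functionD(2)[OF Y]
  have times: "measure ?P (U \<times> V) = measure M U * measure N V" if "U \<in> sets M" "V \<in> sets N" for U V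
    using N.emeasure_pair_measure_Times[OF that] by (simp add: measure_def enn2real_mult)
  have lX: "law ?P ?X = law M X"
    by (rule ext) (simp add: law_def eqX times mX N.prob_space)
  have lY: "law ?P ?Y = law N Y"
    by (rule ext) (simp add: law_def eqY times mY M.prob_space)
  have imX: "?X ` space ?P \<subseteq> X ` space M" and imY: "?Y ` space ?P \<subseteq> Y ` space N"
    by (auto simp: space_pair_measure)
  have fin: "finite (X ` space M)" "finite (Y ` space N)"
    using X Y by (simp_all add: simple_functionD)
  have finX: "finite (?X ` space ?P)" and finY: "finite (?Y ` space ?P)"
    using imX imY fin finite_subset by blast+
  have sX: "simple_function ?P ?X"
    unfolding simple_function_def eqX using finX mX by auto
  have sY: "simple_function ?P ?Y"
    unfolding simple_function_def eqY using finY mY by auto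
  have sXY: "simple_function ?P (\<lambda>\<omega>. ?X \<omega> - ?Y \<omega>)"
    by (intro simple_function_diff sX sY)
  have ind: "measure ?P (?X -` {x} \<inter> ?Y -` {y} \<inter> space ?P) =
      measure ?P (?X -` {x} \<inter> space ?P) * measure ?P (?Y -` {y} \<inter> space ?P)" for x y
    using lX lY by (simp add: fun_eq_iff law_def eqXY times mX mY)
  have lXY: "law ?P (\<lambda>\<omega>. ?X \<omega> - ?Y \<omega>) = r"
  proof
    fix z
    let ?I = "{(x, y). x \<in> X ` space M \<and> y \<in> Y ` space N \<and> x - y = z}"
    have "law ?P (\<lambda>\<omega>. ?X \<omega> - ?Y \<omega>) z = (\<Sum>(x, y)\<in>?I. law ?P ?X x * law ?P ?Y y)"
      unfolding law_def
      by (rule measure_diff_indep[OF P.prob_space_axioms sX sY ind fin(1) imX fin(2) imY])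
    also have "\<dots> = (\<Sum>(x, y)\<in>?I. law M X x * law N Y y)"
      by (simp add: lX lY)
    \<comment> \<open>The fibre x - y = z is parametrised by y. Neither index set need contain the
      other: \<open>z + y\<close> may leave the range of \<open>X\<close>, and the range of
      \<open>Y\<close> may have null values; all such pairs have weight 0.\<close>
    also have "\<dots> = (\<Sum>(x, y)\<in>(\<lambda>y. (z + y, y)) ` ?B. law M X x * law N Y y)"
    proof (rule sum.mono_neutral_cong)
      show "finite ?I"
        by (rule finite_subset[of _ "X ` space M \<times> Y ` space N"]) (use fin in auto)
      show "finite ((\<lambda>y. (z + y, y)) ` ?B)" using Y.finite by simp
      show "(case i of (x, y) \<Rightarrow> law M X x * law N Y y) = 0"
        if "i \<in> (\<lambda>y. (z + y, y)) ` ?B - ?I" for i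
        using that law_support_subset[of M X] law_support_subset[of N Y] X.outside by fastforce
      show "(case i of (x, y) \<Rightarrow> law M X x * law N Y y) = 0"
        if "i \<in> ?I - (\<lambda>y. (z + y, y)) ` ?B" for i
        using that Y.outside by (fastforce simp: image_iff)
    qed simp
    also have "\<dots> = r z"
      by (subst sum.reindex) (auto simp: inj_on_def diff_mass_def)
    finally show "law ?P (\<lambda>\<omega>. ?X \<omega> - ?Y \<omega>) z = r z" .
  qed
  have "shannon_entropy ?P ?X = mass_entropy ?A (law M X)"
    using shannon_entropy_eq_mass_entropy[OF finX X.finite] by (simp add: lX X.outside)
  moreover have "shannon_entropy ?P ?Y = mass_entropy ?B (law N Y)"
    using shannon_entropy_eq_mass_entropy[OF finY Y.finite] by (simp add: lY Y.outside)
  moreover have "shannon_entropy ?P (\<lambda>\<omega>. ?X \<omega> - ?Y \<omega>) = mass_entropy D r"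
    using shannon_entropy_eq_mass_entropy[OF simple_functionD(1)[OF sXY] finite_D]
    by (simp add: lXY diff_mass_outside)
  ultimately show ?thesis
    by (simp add: ent_ruzsa_dist_def Let_def mass_ruzsa_dist_def)
qed

lemma law_uniform_count_measure:
  assumes "finite S"
  shows "law (uniform_count_measure S) (\<lambda>s. s) = (\<lambda>x. indicator S x / card S)"
proof
  fix x
  have "(\<lambda>s. s) -` {x} \<inter> S = (if x \<in> S then {x} else {})" by auto
  then show "law (uniform_count_measure S) (\<lambda>s. s) x = indicator S x / card S"
    using assms by (auto simp: law_def measure_uniform_count_measure space_uniform_count_measure)
qed

theorem proposition1p2:
  fixes C :: real
    and M :: "'b measure" and X :: "'b \<Rightarrow> 'g::ab_group_add"
    and N :: "'c measure" and Y :: "'c \<Rightarrow> 'g"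
  assumes "C \<ge> 4"
    and "prob_space M" and "simple_function M X"
    and "prob_space N" and "simple_function N Y"
  shows "\<exists>S :: 'g set. S \<noteq> {} \<and> finite S \<and>
    ent_ruzsa_dist (uniform_count_measure S) (\<lambda>s. s) N Y
      \<le> (C + 2) * ent_ruzsa_dist M X N Y + binary_entropy (1 - 2 / C) \<and>
    ln (real (card {s - s' | s s'. s \<in> S \<and> s' \<in> S}) / real (card S))
      \<le> (2 * C + 4) * ent_ruzsa_dist M X N Y + 2 * binary_entropy (1 - 2 / C)"
proof -
  interpret two_masses "law_support M X" "law_support N Y" "law M X" "law N Y"
    by (intro two_masses.intro finite_mass_law assms)
  obtain S where S: "S \<noteq> {}" "finite S"
    and dist: "mass_ruzsa_dist S (\<lambda>x. indicator S x / card S) (law_support N Y) (law N Y)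
      \<le> (C + 2) * dist_XY + binary_entropy (1 - 2 / C)"
    and diff: "ln (card (diff_set S S) / card S)
      \<le> (2 * C + 4) * dist_XY + 2 * binary_entropy (1 - 2 / C)"
    using exists_small_doubling_set[OF assms(1)] by blast
  have U: "prob_space (uniform_count_measure S)" "simple_function (uniform_count_measure S) (\<lambda>s. s)"
    using S by (auto intro: prob_space_uniform_count_measure
        simp: simple_function_def space_uniform_count_measure sets_uniform_count_measure)
  \<comment> \<open>Every point of \<open>S\<close> has positive mass, so the distance from U_S to
    \<open>Y\<close> is the one already bounded for masses.\<close>
  have "law_support (uniform_count_measure S) (\<lambda>s. s) = S"
    using S by (auto simp: law_support_def law_uniform_count_measure indicator_def)
  moreover have "{s - s' | s s'. s \<in> S \<and> s' \<in> S} = diff_set S S"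
    by (auto simp: diff_set_def)
  ultimately show ?thesis
    using S dist diff
    by (intro exI[of _ S])
       (simp add: ent_ruzsa_dist_eq_mass_ruzsa_dist assms U law_uniform_count_measure)
qed

end
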